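(* Let $\alpha\in(0,1)$, $C_0\ge 1$, $\lambda>0$, $\varepsilon_0,\varepsilon_1\in(0,1)$, and $v^0\in\mathcal C^{2,\alpha}(\mathbb R^d)$. Assume that $|U|=1$ and that, uniformly for all $u\in U$, $$\Sigma(\cdot,u)\ge \mathbb I_d/C_0,\qquad \|r(\cdot,u)\|_{0,\alpha},\ \|b(\cdot,u)\|_{0,\alpha},\ \|\Sigma(\cdot,u)\|_{0,\alpha}\le C_0 .$$ Assume also that there is a function $\Sigma_0$ on $\mathbb R^d$ with values in the symmetric $d\times d$ matrices such that $M(x,u):=\Sigma(x,u)-\Sigma_0(x)$ satisfies $$\sup_{u\in U}\|M(\cdot,u)\|_\infty\le\varepsilon_0,\qquad \sup_{u\in U}[M(\cdot,u)]_{0,\alpha}\le \varepsilon_1 .$$ Then there exists $A_1\ge1$ depending only on $\|v^0\|_{2,\alpha}$, $C_0$, $\lambda$ and the function $\eta$ (described in the context) such that if $$\rho\ge A_1^{2/(1-\alpha)},\qquad \varepsilon_0A_1\rho^{\alpha/2}\le 1,\qquad \varepsilon_1A_1\le1,$$ then the functions $v^n$ produced by the policy iteration algorithm started from $v^0$ satisfy $$\|v^n\|_2\le A_1\quad\text{and}\quad \rho^{-\alpha/2}[v^n]_{2,\alpha}\le A_1\qquad\text{for all } n\ge1 .$$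
   Context: Setting. $d,m,l$ are fixed positive integers, $U\subset\mathbb R^l$ is a bounded domain with Lebesgue measure $|U|=1$, $\lambda>0$, $\rho>0$, and $r:\mathbb R^d\times U\to\mathbb R$, $b:\mathbb R^d\times U\to\mathbb R^d$, $\sigma:\mathbb R^d\times U\to\mathbb R^{d\times m}$ are given (measurable in $u$); $\Sigma:=\sigma\sigma^T$. $\mathbb I_d$ is the identity matrix, and inequalities between symmetric matrices are in the sense of quadratic forms. Norms on $\mathbb R^d$: for $k\in\mathbb N\cup\{0\}$, $\|w\|_\infty=\sup|w|$, $[\![w]\!]_k=\sup_{|a|_1=k}\|D^aw\|_\infty$ (multi-indices $a$ of order $k$), $[w]_{k,\alpha}=\sup_{|a|_1=k,\ 0<|x-y|\le1}\frac{|D^aw(x)-D^aw(y)|}{|x-y|^\alpha}$, $\|w\|_k=\sum_{j\le k}[\![w]\!]_j$, $\|w\|_{k,\alpha}=\sum_{j\le k}([\![w]\!]_j+[w]_{j,\alpha})$; $\mathcal C^{k,\alpha}(\mathbb R^d)=\{w:\|w\|_{k,\alpha}<\infty\}$. For vector- or matrix-valued functions, $|\cdot|$ is the maximum of the absolute values of the entries. Policy iteration algorithm (PIA): given $v^0$, for $n\ge1$ let $$\pi^n(x,u)=\frac{\exp\left[\frac1\lambda\left(r(x,u)+b(x,u)\cdot Dv^{n-1}(x)+\frac12\mathrm{tr}(\Sigma(x,u)D^2v^{n-1}(x))\right)\right]}{\int_U\exp\left[\frac1\lambda\left(r(x,u')+b(x,u')\cdot Dv^{n-1}(x)+\frac12\mathrm{tr}(\Sigma(x,u')D^2v^{n-1}(x))\right)\right]du'},$$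 and let $v^n$ be the unique bounded (classical) solution on $\mathbb R^d$ of $$\rho v^n-\int_U\left[r(x,u)+b(x,u)\cdot Dv^n+\tfrac12\mathrm{tr}(\Sigma(x,u)D^2v^n)-\lambda\ln\pi^n(x,u)\right]\pi^n(x,u)\,du=0.$$ The function $\eta$: for the given $d,\alpha,C_0$, $\eta:[1,\infty)\to[1,\infty)$ is an increasing function, independent of $\rho$, with the following property (such a function exists). Whenever $\rho\ge1$, $A\ge1$, $\tilde r,\tilde b,\tilde\Sigma$ (real-, $\mathbb R^d$-, and symmetric-matrix-valued functions on $\mathbb R^d$) satisfy $\tilde\Sigma\ge\mathbb I_d/C_0$ and $\|\tilde r\|_{0,\alpha},\|\tilde b\|_{0,\alpha},\|\tilde\Sigma\|_{0,\alpha}\le A$, and $v$ is a bounded solution of $\rho v-\tilde r-\tilde b\cdot Dv-\frac12\mathrm{tr}(\tilde\Sigma D^2v)=0$ on $\mathbb R^d$, one has $$\rho\|v\|_\infty,\ \rho^{1-\frac\alpha2}[v]_{0,\alpha},\ \rho^{\frac12-\frac\alpha2}[v]_{1,\alpha},\ \rho^{-\frac\alpha2}[v]_{2,\alpha},\ \rho^{\frac12}[\![v]\!]_1,\ [\![v]\!]_2\le\eta(A).$$ The dimension $d$ (and $m$, $\alpha$) are regarded as fixed. *)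

theory Defs
  imports "HOL-Analysis.Analysis"
begin

section \<open>Derivatives and Hoelder norms on the Euclidean space\<close>

definition partial_deriv :: "'d \<Rightarrow> (real^'d \<Rightarrow> 'b::euclidean_space) \<Rightarrow> real^'d \<Rightarrow> 'b"
  where "partial_deriv i w x = vector_derivative (\<lambda>t. w (x + t *\<^sub>R axis i 1)) (at 0)"

text \<open>A multi-index of order \<open>k\<close> is represented by a list of coordinates of length \<open>k\<close>.
  The order of the coordinates is irrelevant for functions of class \<open>C\<^sup>k\<close>, and derivatives
  of order \<open>k \<ge> 1\<close> are only ever taken of such functions.\<close>

primrec multi_deriv :: "'d list \<Rightarrow> (real^'d \<Rightarrow> 'b::euclidean_space) \<Rightarrow> real^'d \<Rightarrow> 'b"
  where
    "multi_deriv [] w = w"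
  | "multi_deriv (i # a) w = partial_deriv i (multi_deriv a w)"

primrec C_class :: "nat \<Rightarrow> (real^'d \<Rightarrow> 'b::euclidean_space) \<Rightarrow> bool"
  where
    "C_class 0 w \<longleftrightarrow> continuous_on UNIV w"
  | "C_class (Suc k) w \<longleftrightarrow>
       (\<forall>x. w differentiable (at x)) \<and> (\<forall>i. C_class k (partial_deriv i w))"

text \<open>All norms take values in \<open>[0, \<infinity>]\<close>.  The absolute value of a value of \<open>w\<close> is
  \<^const>\<open>infnorm\<close>, which is \<open>\<bar>_\<bar>\<close> on the reals and the maximum of the absolute values of the
  entries for vectors in \<open>real^'d\<close> and for matrices in \<open>real^'n^'m\<close>; the distance of two
  points is the Euclidean one.\<close>

definition sup_norm :: "(real^'d \<Rightarrow> 'b::euclidean_space) \<Rightarrow> ennreal"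
  where "sup_norm w = (SUP x. ennreal (infnorm (w x)))"

definition deriv_seminorm :: "nat \<Rightarrow> (real^'d \<Rightarrow> 'b::euclidean_space) \<Rightarrow> ennreal"
  where "deriv_seminorm k w = (SUP a\<in>{a. length a = k}. sup_norm (multi_deriv a w))"

definition holder_seminorm :: "nat \<Rightarrow> real \<Rightarrow> (real^'d \<Rightarrow> 'b::euclidean_space) \<Rightarrow> ennreal"
  where "holder_seminorm k \<alpha> w =
    (SUP a\<in>{a. length a = k}. SUP (x, y)\<in>{(x, y). 0 < dist x y \<and> dist x y \<le> 1}.
       ennreal (infnorm (multi_deriv a w x - multi_deriv a w y) / dist x y powr \<alpha>))"

definition C_norm :: "nat \<Rightarrow> (real^'d \<Rightarrow> 'b::euclidean_space) \<Rightarrow> ennreal"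
  where "C_norm k w = (\<Sum>j\<le>k. deriv_seminorm j w)"

definition holder_norm :: "nat \<Rightarrow> real \<Rightarrow> (real^'d \<Rightarrow> 'b::euclidean_space) \<Rightarrow> ennreal"
  where "holder_norm k \<alpha> w = (\<Sum>j\<le>k. deriv_seminorm j w + holder_seminorm j \<alpha> w)"

definition holder_space :: "nat \<Rightarrow> real \<Rightarrow> (real^'d \<Rightarrow> 'b::euclidean_space) set"
  where "holder_space k \<alpha> = {w. C_class k w \<and> holder_norm k \<alpha> w < \<infinity>}"

definition grad :: "(real^'d \<Rightarrow> real) \<Rightarrow> real^'d \<Rightarrow> real^'d"
  where "grad w x = (\<chi> i. partial_deriv i w x)"

definition hessian :: "(real^'d \<Rightarrow> real) \<Rightarrow> real^'d \<Rightarrow> real^'d^'d"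
  where "hessian w x = (\<chi> i j. partial_deriv i (partial_deriv j w) x)"

definition quadform_le :: "real^'d^'d \<Rightarrow> real^'d^'d \<Rightarrow> bool"
  where "quadform_le A B \<longleftrightarrow> (\<forall>\<xi>. \<xi> \<bullet> (A *v \<xi>) \<le> \<xi> \<bullet> (B *v \<xi>))"

definition bounded_classical :: "(real^'d \<Rightarrow> real) \<Rightarrow> bool"
  where "bounded_classical w \<longleftrightarrow> C_class 2 w \<and> bounded (range w)"


section \<open>The function \<open>\<eta>\<close> of the a priori estimates\<close>

definition apriori_bound :: "'d::finite itself \<Rightarrow> real \<Rightarrow> real \<Rightarrow> (real \<Rightarrow> real) \<Rightarrow> bool"
  where "apriori_bound _ \<alpha> C\<^sub>0 \<eta> \<longleftrightarrow>
    (\<forall>A\<ge>1. \<eta> A \<ge> 1) \<and> mono_on {1..} \<eta> \<and>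
    (\<forall>\<rho>\<ge>1. \<forall>A\<ge>1. \<forall>(r :: real^'d \<Rightarrow> real) (b :: real^'d \<Rightarrow> real^'d) (S :: real^'d \<Rightarrow> real^'d^'d) v.
       (\<forall>x. transpose (S x) = S x) \<longrightarrow>
       (\<forall>x. quadform_le ((1 / C\<^sub>0) *\<^sub>R mat 1) (S x)) \<longrightarrow>
       holder_norm 0 \<alpha> r \<le> ennreal A \<longrightarrow>
       holder_norm 0 \<alpha> b \<le> ennreal A \<longrightarrow>
       holder_norm 0 \<alpha> S \<le> ennreal A \<longrightarrow>
       bounded_classical v \<longrightarrow>
       (\<forall>x. \<rho> * v x - r x - b x \<bullet> grad v x - 1/2 * trace (S x ** hessian v x) = 0) \<longrightarrow>
         ennreal \<rho> * sup_norm v \<le> ennreal (\<eta> A) \<and>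
         ennreal (\<rho> powr (1 - \<alpha>/2)) * holder_seminorm 0 \<alpha> v \<le> ennreal (\<eta> A) \<and>
         ennreal (\<rho> powr (1/2 - \<alpha>/2)) * holder_seminorm 1 \<alpha> v \<le> ennreal (\<eta> A) \<and>
         ennreal (\<rho> powr (- \<alpha>/2)) * holder_seminorm 2 \<alpha> v \<le> ennreal (\<eta> A) \<and>
         ennreal (\<rho> powr (1/2)) * deriv_seminorm 1 v \<le> ennreal (\<eta> A) \<and>
         deriv_seminorm 2 v \<le> ennreal (\<eta> A))"


section \<open>The control domain\<close>

text \<open>The constant in the theorem may not depend on the dimension \<open>l\<close> of the control space,
  so \<open>l\<close> has to be quantified inside the statement and cannot be a type. Hence \<open>\<real>\<^sup>l\<close> is the
  extensional function space \<open>{..<l} \<rightarrow>\<^sub>E UNIV\<close> with its product topology and the completed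
  product of the one-dimensional Lebesgue measures.\<close>

definition lebesgue_Rn :: "nat \<Rightarrow> (nat \<Rightarrow> real) measure"
  where "lebesgue_Rn l = completion (PiM {..<l} (\<lambda>_. lborel))"

definition bounded_domain :: "nat \<Rightarrow> (nat \<Rightarrow> real) set \<Rightarrow> bool"
  where "bounded_domain l U \<longleftrightarrow>
    U \<noteq> {} \<and>
    openin (product_topology (\<lambda>_. euclidean) {..<l}) U \<and>
    connectedin (product_topology (\<lambda>_. euclidean) {..<l}) U \<and>
    (\<exists>B. \<forall>u\<in>U. \<forall>i<l. \<bar>u i\<bar> \<le> B)"


section \<open>Policy iteration\<close>

text \<open>Throughout, \<open>\<Omega>\<close> is the control domain \<open>U\<close> with its Lebesgue measure,
  i.e. \<open>restrict_space (lebesgue_Rn l) U\<close>.\<close>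

definition diffusion :: "(real^'d \<Rightarrow> 'u \<Rightarrow> real^'m^'d) \<Rightarrow> real^'d \<Rightarrow> 'u \<Rightarrow> real^'d^'d"
  where "diffusion \<sigma> x u = \<sigma> x u ** transpose (\<sigma> x u)"

definition hamiltonian ::
  "(real^'d \<Rightarrow> 'u \<Rightarrow> real) \<Rightarrow> (real^'d \<Rightarrow> 'u \<Rightarrow> real^'d) \<Rightarrow> (real^'d \<Rightarrow> 'u \<Rightarrow> real^'m^'d) \<Rightarrow>
   (real^'d \<Rightarrow> real) \<Rightarrow> real^'d \<Rightarrow> 'u \<Rightarrow> real"
  where "hamiltonian r b \<sigma> w x u =
    r x u + b x u \<bullet> grad w x + 1/2 * trace (diffusion \<sigma> x u ** hessian w x)"

definition policy ::
  "'u measure \<Rightarrow> real \<Rightarrow> (real^'d \<Rightarrow> 'u \<Rightarrow> real) \<Rightarrow> (real^'d \<Rightarrow> 'u \<Rightarrow> real^'d) \<Rightarrow>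
   (real^'d \<Rightarrow> 'u \<Rightarrow> real^'m^'d) \<Rightarrow> (real^'d \<Rightarrow> real) \<Rightarrow> real^'d \<Rightarrow> 'u \<Rightarrow> real"
  where "policy \<Omega> lam r b \<sigma> w x u =
    exp (1 / lam * hamiltonian r b \<sigma> w x u) /
    (LINT u'|\<Omega>. exp (1 / lam * hamiltonian r b \<sigma> w x u'))"

text \<open>The iterate \<open>v n\<close> is described by the equation that it solves. The bounded classical
  solution is unique under the hypotheses of the theorem, so nothing else has to be said to
  identify it.\<close>

definition policy_iteration ::
  "'u measure \<Rightarrow> real \<Rightarrow> real \<Rightarrow> (real^'d \<Rightarrow> 'u \<Rightarrow> real) \<Rightarrow> (real^'d \<Rightarrow> 'u \<Rightarrow> real^'d) \<Rightarrow>
   (real^'d \<Rightarrow> 'u \<Rightarrow> real^'m^'d) \<Rightarrow> (nat \<Rightarrow> real^'d \<Rightarrow> real) \<Rightarrow> bool"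
  where "policy_iteration \<Omega> lam \<rho> r b \<sigma> v \<longleftrightarrow>
    (\<forall>n\<ge>1. bounded_classical (v n) \<and>
      (\<forall>x. \<rho> * v n x -
        (LINT u|\<Omega>.
          (hamiltonian r b \<sigma> (v n) x u - lam * ln (policy \<Omega> lam r b \<sigma> (v (n - 1)) x u))
          * policy \<Omega> lam r b \<sigma> (v (n - 1)) x u) = 0))"

end

theory Submission
  imports Defs "HOL-Probability.Probability_Measure"
begin

text \<open>The part of the Hamiltonian that contains \<open>\<Sigma>\<^sub>0\<close> does not depend on the control and cancels
  in the policy, so the policy only sees the perturbation \<open>b \<bullet> Dw + 1/2 tr (M D\<^sup>2w)\<close> with
  \<open>M = \<Sigma> - \<Sigma>\<^sub>0\<close>. If the perturbation of one iterate is bounded by \<open>B\<close> in the Hoelder norm, the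
  averaged coefficients of the equation for the next iterate are bounded by a constant \<open>A\<close> that
  depends only on \<open>C\<^sub>0\<close>, \<open>\<lambda>\<close> and \<open>B\<close>, and the a priori estimates bound that iterate by \<open>\<eta> A\<close>. For large
  \<open>\<rho>\<close> and small \<open>\<epsilon>\<^sub>0\<close>, \<open>\<epsilon>\<^sub>1\<close> its perturbation is then at most \<open>1\<close>, however large \<open>\<eta> A\<close> is, and the
  induction closes with the bound \<open>B\<close> dictated by \<open>v\<^sup>0\<close>.\<close>

section \<open>Extended-valued norms as pointwise inequalities\<close>

lemma infnorm_le_iff:
  fixes x :: "'a::euclidean_space"
  shows "infnorm x \<le> c \<longleftrightarrow> (\<forall>i\<in>Basis. \<bar>x \<bullet> i\<bar> \<le> c)"
  by (simp add: infnorm_Max)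

lemma infnorm_real_eq_abs: "infnorm (x::real) = \<bar>x\<bar>"
  by (simp add: infnorm_Max)

lemma infnorm_vec_le_iff:
  fixes x :: "'a::euclidean_space^'n"
  shows "infnorm x \<le> c \<longleftrightarrow> (\<forall>i. infnorm (x $ i) \<le> c)"
  by (auto simp: infnorm_le_iff Basis_vec_def inner_axis)

lemma sup_norm_le_iff:
  assumes "0 \<le> c"
  shows "sup_norm w \<le> ennreal c \<longleftrightarrow> (\<forall>x. infnorm (w x) \<le> c)"
  using assms by (simp add: sup_norm_def SUP_le_iff)

lemma deriv_seminorm_le_iff:
  assumes "0 \<le> c"
  shows "deriv_seminorm k w \<le> ennreal c \<longleftrightarrow>
    (\<forall>a x. length a = k \<longrightarrow> infnorm (multi_deriv a w x) \<le> c)"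
  using assms by (auto simp: deriv_seminorm_def SUP_le_iff sup_norm_le_iff)

text \<open>Multiplying out the quotient makes the diagonal \<open>x = y\<close> harmless, since the
  left side vanishes there. Later estimates therefore need no case distinction on
  \<open>x = y\<close>.\<close>

lemma holder_seminorm_le_iff:
  assumes "0 \<le> c"
  shows "holder_seminorm k \<alpha> w \<le> ennreal c \<longleftrightarrow>
    (\<forall>a x y. length a = k \<longrightarrow> dist x y \<le> 1 \<longrightarrow>
      infnorm (multi_deriv a w x - multi_deriv a w y) \<le> c * dist x y powr \<alpha>)"
proof -
  have "ennreal (infnorm (multi_deriv a w x - multi_deriv a w y) / dist x y powr \<alpha>) \<le> ennreal c \<longleftrightarrow>
      infnorm (multi_deriv a w x - multi_deriv a w y) \<le> c * dist x y powr \<alpha>"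
    if "0 < dist x y" for a x y
    using that assms by (simp add: divide_le_eq)
  then have "holder_seminorm k \<alpha> w \<le> ennreal c \<longleftrightarrow>
      (\<forall>a x y. length a = k \<longrightarrow> 0 < dist x y \<longrightarrow> dist x y \<le> 1 \<longrightarrow>
        infnorm (multi_deriv a w x - multi_deriv a w y) \<le> c * dist x y powr \<alpha>)"
    using assms by (auto simp: holder_seminorm_def SUP_le_iff)
  moreover have "infnorm (multi_deriv a w x - multi_deriv a w x) \<le> c * dist x x powr \<alpha>" for a x
    by (simp add: infnorm_0)
  ultimately show ?thesis
    by (metis zero_less_dist_iff)
qed

section \<open>Calculus of bounded Hoelder continuous scalar functions\<close>

text \<open>The sup bound and the Hoelder constant are kept apart because they scale differently:
  \<rho> enters those of the Hessian differently, and those of \<open>M\<close> are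
  \<open>\<epsilon>\<^sub>0\<close> and \<open>\<epsilon>\<^sub>1\<close>. The sign conditions are
  built in so that products need no side conditions.\<close>

definition holder_bounded :: "real \<Rightarrow> real \<Rightarrow> real \<Rightarrow> ('a::metric_space \<Rightarrow> real) \<Rightarrow> bool"
  where "holder_bounded \<alpha> F G f \<longleftrightarrow> 0 \<le> F \<and> 0 \<le> G \<and> (\<forall>x. \<bar>f x\<bar> \<le> F) \<and>
    (\<forall>x y. dist x y \<le> 1 \<longrightarrow> \<bar>f x - f y\<bar> \<le> G * dist x y powr \<alpha>)"

lemma holder_boundedI:
  assumes "0 \<le> F" "0 \<le> G" "\<And>x. \<bar>f x\<bar> \<le> F"
    and "\<And>x y. dist x y \<le> 1 \<Longrightarrow> \<bar>f x - f y\<bar> \<le> G * dist x y powr \<alpha>"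
  shows "holder_bounded \<alpha> F G f"
  using assms by (simp add: holder_bounded_def)

lemma holder_boundedD:
  assumes "holder_bounded \<alpha> F G f"
  shows "0 \<le> F" "0 \<le> G" "\<bar>f x\<bar> \<le> F"
    and "dist x y \<le> 1 \<Longrightarrow> \<bar>f x - f y\<bar> \<le> G * dist x y powr \<alpha>"
  using assms by (auto simp: holder_bounded_def)

lemma holder_bounded_mono:
  assumes "holder_bounded \<alpha> F G f" "F \<le> F'" "G \<le> G'"
  shows "holder_bounded \<alpha> F' G' f"
proof (rule holder_boundedI)
  show "0 \<le> F'" "0 \<le> G'" "\<bar>f x\<bar> \<le> F'" for x
    using holder_boundedD(1-3)[OF assms(1)] assms(2,3) order_trans by blast+
  show "\<bar>f x - f y\<bar> \<le> G' * dist x y powr \<alpha>" if "dist x y \<le> 1" for x y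
    using holder_boundedD(4)[OF assms(1) that] mult_right_mono[OF assms(3), of "dist x y powr \<alpha>"]
    by simp
qed

lemma holder_bounded_add:
  assumes "holder_bounded \<alpha> F G f" "holder_bounded \<alpha> F' G' f'"
  shows "holder_bounded \<alpha> (F + F') (G + G') (\<lambda>x. f x + f' x)"
proof (rule holder_boundedI)
  show "0 \<le> F + F'" "0 \<le> G + G'"
    using holder_boundedD[OF assms(1)] holder_boundedD[OF assms(2)] by auto
  show "\<bar>f x + f' x\<bar> \<le> F + F'" for x
    using holder_boundedD(3)[OF assms(1), of x] holder_boundedD(3)[OF assms(2), of x] by linarith
  show "\<bar>f x + f' x - (f y + f' y)\<bar> \<le> (G + G') * dist x y powr \<alpha>" if "dist x y \<le> 1" for x y
    using holder_boundedD(4)[OF assms(1) that] holder_boundedD(4)[OF assms(2) that]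
    unfolding distrib_right by linarith
qed

text \<open>The usual product splitting pairs each Hoelder constant with the sup bound of the other
  factor, so no product of two Hoelder constants occurs.\<close>

lemma holder_bounded_mult:
  assumes "holder_bounded \<alpha> F G f" "holder_bounded \<alpha> F' G' f'"
  shows "holder_bounded \<alpha> (F * F') (F * G' + G * F') (\<lambda>x. f x * f' x)"
proof (rule holder_boundedI)
  note f = holder_boundedD[OF assms(1)] and f' = holder_boundedD[OF assms(2)]
  show "0 \<le> F * F'" "0 \<le> F * G' + G * F'"
    using f f' by auto
  show "\<bar>f x * f' x\<bar> \<le> F * F'" for x
    using f f' by (simp add: abs_mult mult_mono)
  show "\<bar>f x * f' x - f y * f' y\<bar> \<le> (F * G' + G * F') * dist x y powr \<alpha>" if "dist x y \<le> 1" for x y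
  proof -
    have "\<bar>f x * f' x - f y * f' y\<bar> = \<bar>f x * (f' x - f' y) + (f x - f y) * f' y\<bar>"
      by (simp add: algebra_simps)
    also have "\<dots> \<le> \<bar>f x\<bar> * \<bar>f' x - f' y\<bar> + \<bar>f x - f y\<bar> * \<bar>f' y\<bar>"
      by (metis abs_mult abs_triangle_ineq)
    also have "\<dots> \<le> F * (G' * dist x y powr \<alpha>) + (G * dist x y powr \<alpha>) * F'"
      using f f' that by (intro add_mono mult_mono) auto
    finally show ?thesis by (simp add: algebra_simps)
  qed
qed

lemma holder_bounded_const: "0 \<le> G \<Longrightarrow> holder_bounded \<alpha> \<bar>c\<bar> G (\<lambda>_. c)"
  by (simp add: holder_bounded_def)

lemma holder_bounded_cmult:
  assumes "holder_bounded \<alpha> F G f"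
  shows "holder_bounded \<alpha> (\<bar>c\<bar> * F) (\<bar>c\<bar> * G) (\<lambda>x. c * f x)"
  using holder_bounded_mult[OF holder_bounded_const[of 0 \<alpha> c] assms] by simp

lemma holder_bounded_sum:
  assumes "\<And>i. i \<in> I \<Longrightarrow> holder_bounded \<alpha> F G (f i)"
  shows "holder_bounded \<alpha> (real (card I) * F) (real (card I) * G) (\<lambda>x. \<Sum>i\<in>I. f i x)"
  using assms
proof (induction I rule: infinite_finite_induct)
  case (insert i I)
  then have "holder_bounded \<alpha> (F + real (card I) * F) (G + real (card I) * G) (\<lambda>x. f i x + (\<Sum>i\<in>I. f i x))"
    by (intro holder_bounded_add) auto
  with insert show ?case by (simp add: algebra_simps)
qed (simp_all add: holder_bounded_def)

section \<open>From the norms to the scalar entries\<close>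

lemma holder_norm_0: "holder_norm 0 \<alpha> w = sup_norm w + holder_seminorm 0 \<alpha> w"
  by (simp add: holder_norm_def deriv_seminorm_def)

lemma holder_seminorm_0_le_iff:
  assumes "0 \<le> c"
  shows "holder_seminorm 0 \<alpha> w \<le> ennreal c \<longleftrightarrow>
    (\<forall>x y. dist x y \<le> 1 \<longrightarrow> infnorm (w x - w y) \<le> c * dist x y powr \<alpha>)"
  using assms by (simp add: holder_seminorm_le_iff)

lemma holder_norm_0_leD:
  assumes "holder_norm 0 \<alpha> w \<le> ennreal c"
  shows "sup_norm w \<le> ennreal c" "holder_seminorm 0 \<alpha> w \<le> ennreal c"
  using assms unfolding holder_norm_0 by (auto intro: order_trans[rotated])

lemma holder_norm_0_le:
  assumes "sup_norm w \<le> ennreal F \<and> holder_seminorm 0 \<alpha> w \<le> ennreal G"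
    and "0 \<le> F" "0 \<le> G" "F + G \<le> A"
  shows "holder_norm 0 \<alpha> w \<le> ennreal A"
proof -
  have "holder_norm 0 \<alpha> w \<le> ennreal F + ennreal G"
    unfolding holder_norm_0 using assms(1) by (intro add_mono) auto
  also have "\<dots> \<le> ennreal A"
    using assms by (simp flip: ennreal_plus)
  finally show ?thesis .
qed

lemma holder_bounded_real_iff:
  assumes "0 \<le> F" "0 \<le> G"
  shows "sup_norm w \<le> ennreal F \<and> holder_seminorm 0 \<alpha> w \<le> ennreal G \<longleftrightarrow> holder_bounded \<alpha> F G w"
  using assms by (simp add: sup_norm_le_iff holder_seminorm_0_le_iff infnorm_real_eq_abs holder_bounded_def)

text \<open>Since \<open>infnorm\<close> is the maximum over the entries, passing to entries costs
  no dimensional factor.\<close>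

lemma holder_bounded_vec_iff:
  fixes w :: "real^'d \<Rightarrow> real^'n"
  assumes "0 \<le> F" "0 \<le> G"
  shows "sup_norm w \<le> ennreal F \<and> holder_seminorm 0 \<alpha> w \<le> ennreal G \<longleftrightarrow>
    (\<forall>i. holder_bounded \<alpha> F G (\<lambda>x. w x $ i))"
  using assms
  by (auto simp: sup_norm_le_iff holder_seminorm_0_le_iff infnorm_vec_le_iff infnorm_real_eq_abs holder_bounded_def)

lemma holder_bounded_mat_iff:
  fixes w :: "real^'d \<Rightarrow> real^'n^'m"
  assumes "0 \<le> F" "0 \<le> G"
  shows "sup_norm w \<le> ennreal F \<and> holder_seminorm 0 \<alpha> w \<le> ennreal G \<longleftrightarrow>
    (\<forall>i j. holder_bounded \<alpha> F G (\<lambda>x. w x $ i $ j))"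
  using assms
  by (auto simp: sup_norm_le_iff holder_seminorm_0_le_iff infnorm_vec_le_iff infnorm_real_eq_abs holder_bounded_def)

lemma holder_bounded_grad:
  assumes "deriv_seminorm 1 w \<le> ennreal F" "holder_seminorm 1 \<alpha> w \<le> ennreal G" "0 \<le> F" "0 \<le> G"
  shows "holder_bounded \<alpha> F G (\<lambda>x. grad w x $ i)"
proof (rule holder_boundedI)
  show "\<bar>grad w x $ i\<bar> \<le> F" for x
    using assms(1,3) by (auto simp: deriv_seminorm_le_iff grad_def infnorm_real_eq_abs dest: spec[of _ "[i]"])
  show "\<bar>grad w x $ i - grad w y $ i\<bar> \<le> G * dist x y powr \<alpha>" if "dist x y \<le> 1" for x y
    using assms(2,4) that
    by (auto simp: holder_seminorm_le_iff grad_def infnorm_real_eq_abs dest!: spec[of _ "[i]"])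
qed (use assms in auto)

text \<open>The list \<open>[i, j]\<close> differentiates in direction \<open>j\<close> first, which
  is the order used in \<open>hessian\<close>, so the entries match literally.\<close>

lemma holder_bounded_hessian:
  assumes "deriv_seminorm 2 w \<le> ennreal F" "holder_seminorm 2 \<alpha> w \<le> ennreal G" "0 \<le> F" "0 \<le> G"
  shows "holder_bounded \<alpha> F G (\<lambda>x. hessian w x $ i $ j)"
proof (rule holder_boundedI)
  show "\<bar>hessian w x $ i $ j\<bar> \<le> F" for x
    using assms(1,3)
    by (auto simp: deriv_seminorm_le_iff hessian_def infnorm_real_eq_abs dest: spec[of _ "[i, j]"])
  show "\<bar>hessian w x $ i $ j - hessian w y $ i $ j\<bar> \<le> G * dist x y powr \<alpha>" if "dist x y \<le> 1" for x y
    using assms(2,4) that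
    by (auto simp: holder_seminorm_le_iff hessian_def infnorm_real_eq_abs dest!: spec[of _ "[i, j]"])
qed (use assms in auto)

lemma ennreal_mult_leD:
  assumes "ennreal c * x \<le> ennreal L" "0 < c" "0 \<le> L"
  shows "x \<le> ennreal (L / c)"
proof -
  have "x = ennreal (1 / c) * (ennreal c * x)"
    using assms(2) by (simp flip: mult.assoc ennreal_mult)
  also have "\<dots> \<le> ennreal (1 / c) * ennreal L"
    using assms(1) by (rule mult_left_mono) simp
  finally show ?thesis
    using assms(2,3) by (simp flip: ennreal_mult)
qed

section \<open>Gibbs densities and averages against them\<close>

definition gibbs :: "'u measure \<Rightarrow> ('u \<Rightarrow> real) \<Rightarrow> 'u \<Rightarrow> real"
  where "gibbs M k u = exp (k u) / (LINT u'|M. exp (k u'))"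

text \<open>The factor \<open>exp c\<close> appears in the numerator and in the normalising integral
  and cancels.\<close>

lemma gibbs_add_const: "gibbs M (\<lambda>u. k u + c) = gibbs M k"
  by (simp add: gibbs_def exp_add fun_eq_iff)

lemma borel_measurable_gibbs [measurable]:
  "k \<in> borel_measurable M \<Longrightarrow> gibbs M k \<in> borel_measurable M"
  unfolding gibbs_def by (rule borel_measurable_divide) auto

text \<open>The slope of the exponential on the half-line below \<open>c\<close> is at most
  \<open>exp c\<close>; the proof uses its tangent at 0.\<close>

lemma abs_diff_exp_le:
  fixes s t c :: real
  assumes "s \<le> c" "t \<le> c"
  shows "\<bar>exp s - exp t\<bar> \<le> exp c * \<bar>s - t\<bar>"
proof -
  have *: "exp t - exp s \<le> exp c * (t - s)" if "s \<le> t" "t \<le> c" for s t :: real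
  proof -
    have "exp t - exp s = exp t * (1 - exp (s - t))"
      by (simp add: algebra_simps flip: exp_add)
    also have "\<dots> \<le> exp t * (t - s)"
      using exp_ge_add_one_self[of "s - t"] by (intro mult_left_mono) (linarith, simp)
    also have "\<dots> \<le> exp c * (t - s)"
      using that by (intro mult_right_mono) auto
    finally show ?thesis .
  qed
  show ?thesis
    using *[of s t] *[of t s] assms by (cases "s \<le> t") auto
qed

context prob_space
begin

lemma abs_integral_le:
  fixes f g :: "'a \<Rightarrow> real"
  assumes "integrable M f" "integrable M g" "\<And>u. u \<in> space M \<Longrightarrow> \<bar>f u\<bar> \<le> g u"
  shows "\<bar>LINT u|M. f u\<bar> \<le> (LINT u|M. g u)"
proof -
  have "\<bar>LINT u|M. f u\<bar> \<le> (LINT u|M. \<bar>f u\<bar>)"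
    by (rule integral_abs_bound)
  also have "\<dots> \<le> (LINT u|M. g u)"
    using assms by (intro integral_mono) auto
  finally show ?thesis .
qed

lemma integrable_bounded:
  fixes f :: "'a \<Rightarrow> real"
  assumes "f \<in> borel_measurable M" "\<And>u. u \<in> space M \<Longrightarrow> \<bar>f u\<bar> \<le> B"
  shows "integrable M f"
  using assms by (intro integrable_const_bound[where B = B]) auto

lemma integrable_exp_bounded:
  assumes [measurable]: "k \<in> borel_measurable M" and "\<And>u. u \<in> space M \<Longrightarrow> \<bar>k u\<bar> \<le> B"
  shows "integrable M (\<lambda>u. exp (k u :: real))"
  using assms(2) by (intro integrable_bounded[where B = "exp B"]) (auto dest: abs_le_D1)

lemma integral_exp_pos:
  assumes "k \<in> borel_measurable M" "\<And>u. u \<in> space M \<Longrightarrow> \<bar>k u\<bar> \<le> B"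
  shows "0 < (LINT u|M. exp (k u :: real))"
proof -
  have "exp (- B) \<le> (LINT u|M. exp (k u))"
    by (intro integral_ge_const integrable_exp_bounded[OF assms] AE_I2)
       (use assms(2) in \<open>force simp: abs_le_iff\<close>)+
  then show ?thesis
    using exp_gt_zero[of "- B"] by linarith
qed

lemma gibbs_pos:
  assumes "k \<in> borel_measurable M" "\<And>u. u \<in> space M \<Longrightarrow> \<bar>k u\<bar> \<le> B"
  shows "0 < gibbs M k u"
  using integral_exp_pos[OF assms] by (simp add: gibbs_def)

lemma integral_gibbs:
  assumes "k \<in> borel_measurable M" "\<And>u. u \<in> space M \<Longrightarrow> \<bar>k u\<bar> \<le> B"
  shows "(LINT u|M. gibbs M k u) = 1"
  using integral_exp_pos[OF assms] by (simp add: gibbs_def)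

text \<open>If the exponents differ by at most \<open>e\<close>, the normalising integrals differ by
  a factor of at most \<open>exp e\<close>. Hence \<open>e\<close> is paid once for the exponent and
  once for the logarithm of the integral. \<open>B\<close> and \<open>B'\<close> secure
  integrability and do not enter the constant.\<close>

lemma ln_gibbs_diff_le:
  assumes k: "k \<in> borel_measurable M" "\<And>u. u \<in> space M \<Longrightarrow> \<bar>k u\<bar> \<le> B"
    and k': "k' \<in> borel_measurable M" "\<And>u. u \<in> space M \<Longrightarrow> \<bar>k' u\<bar> \<le> B'"
    and diff: "\<And>u. u \<in> space M \<Longrightarrow> \<bar>k u - k' u\<bar> \<le> e"
    and u: "u \<in> space M"
  shows "\<bar>ln (gibbs M k u) - ln (gibbs M k' u)\<bar> \<le> 2 * e"
proof -
  define Z Z' where "Z = (LINT u|M. exp (k u))" and "Z' = (LINT u|M. exp (k' u))"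
  note pos = integral_exp_pos[OF k, folded Z_def] integral_exp_pos[OF k', folded Z'_def]
  have "Z \<le> (LINT u|M. exp e * exp (k' u))"
    unfolding Z_def using diff
    by (intro integral_mono integrable_exp_bounded[OF k] integrable_mult_right integrable_exp_bounded[OF k'])
       (auto simp: abs_le_iff simp flip: exp_add dest: diff)
  then have "Z \<le> exp e * Z'" by (simp add: Z'_def)
  moreover have "Z' \<le> (LINT u|M. exp e * exp (k u))"
    unfolding Z'_def using diff
    by (intro integral_mono integrable_exp_bounded[OF k'] integrable_mult_right integrable_exp_bounded[OF k])
       (auto simp: abs_le_iff simp flip: exp_add dest: diff)
  then have "Z' \<le> exp e * Z" by (simp add: Z_def)
  ultimately have "ln Z \<le> ln (exp e * Z')" "ln Z' \<le> ln (exp e * Z)"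
    using pos by (auto intro!: ln_mono)
  then have "\<bar>ln Z - ln Z'\<bar> \<le> e"
    using pos by (auto simp: ln_mult)
  moreover have "ln (gibbs M k u) = k u - ln Z" "ln (gibbs M k' u) = k' u - ln Z'"
    using pos by (simp_all add: gibbs_def ln_div flip: Z_def Z'_def)
  ultimately show ?thesis using diff[OF u] by linarith
qed

text \<open>Comparison with the exponent 0, whose Gibbs density on a probability space is
  identically 1.\<close>

lemma ln_gibbs_le:
  assumes "k \<in> borel_measurable M" "\<And>u. u \<in> space M \<Longrightarrow> \<bar>k u\<bar> \<le> B" "u \<in> space M"
  shows "\<bar>ln (gibbs M k u)\<bar> \<le> 2 * B"
  using ln_gibbs_diff_le[OF assms(1,2), of "\<lambda>_. 0" 0 B u] assms by (simp add: gibbs_def prob_space)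

text \<open>The logarithm of the Gibbs density varies with the parameter at most twice as much as the
  exponent does, whatever the measure.\<close>

lemma holder_bounded_gibbs_average:
  fixes f k :: "'p::metric_space \<Rightarrow> 'a \<Rightarrow> real"
  assumes k [measurable]: "\<And>x. k x \<in> borel_measurable M"
    and kB: "\<And>u. u \<in> space M \<Longrightarrow> holder_bounded \<alpha> B B (\<lambda>x. k x u)"
    and f [measurable]: "\<And>x. f x \<in> borel_measurable M"
    and fF: "\<And>u. u \<in> space M \<Longrightarrow> holder_bounded \<alpha> F F (\<lambda>x. f x u)"
    and c: "c = 2 * B"
  shows "holder_bounded \<alpha> F (F * (1 + c * exp c)) (\<lambda>x. LINT u|M. f x u * gibbs M (k x) u)"
proof -
  obtain u0 where u0: "u0 \<in> space M" using not_empty by blast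
  have B0: "0 \<le> B" using holder_boundedD(1)[OF kB[OF u0]] .
  have F0: "0 \<le> F" using holder_boundedD(1)[OF fF[OF u0]] .
  have kb: "\<bar>k x u\<bar> \<le> B" if "u \<in> space M" for x u
    using holder_boundedD(3)[OF kB[OF that]] .
  have fb: "\<bar>f x u\<bar> \<le> F" if "u \<in> space M" for x u
    using holder_boundedD(3)[OF fF[OF that]] .
  define g where "g x u = gibbs M (k x) u" for x u
  have g_meas [measurable]: "g x \<in> borel_measurable M" for x
    unfolding g_def by measurable
  have g_pos: "0 < g x u" for x u
    unfolding g_def using gibbs_pos[OF k kb] .
  have ln_g: "ln (g x u) \<le> c" if "u \<in> space M" for x u
    using ln_gibbs_le[OF k kb that] by (simp add: g_def c abs_le_iff)
  have g_exp: "g x u = exp (ln (g x u))" for x u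
    using g_pos by simp
  have g_le: "\<bar>g x u\<bar> \<le> exp c" if "u \<in> space M" for x u
    using ln_g[OF that, of x] g_pos[of x u] by (metis abs_of_pos exp_le_cancel_iff g_exp)
  have g_int: "integrable M (g x)" for x
    by (rule integrable_bounded[where B = "exp c"]) (use g_le in auto)
  have g_one: "(LINT u|M. g x u) = 1" for x
    unfolding g_def using integral_gibbs[OF k kb] .
  have fg_int: "integrable M (\<lambda>u. f x u * g x u)" for x
    by (rule integrable_bounded[where B = "F * exp c"]) (use fb g_le F0 in \<open>auto simp: abs_mult intro!: mult_mono\<close>)
  show ?thesis
    unfolding g_def[symmetric]
  proof (rule holder_boundedI)
    show "0 \<le> F" "0 \<le> F * (1 + c * exp c)" using F0 B0 c by auto
    \<comment> \<open>The density integrates to 1, so the sup bound of \<open>f\<close> passes to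
      the average without the factor \<open>exp c\<close>.\<close>
    show "\<bar>LINT u|M. f x u * g x u\<bar> \<le> F" for x
    proof -
      have "\<bar>LINT u|M. f x u * g x u\<bar> \<le> (LINT u|M. F * g x u)"
      proof (rule abs_integral_le)
        show "\<bar>f x u * g x u\<bar> \<le> F * g x u" if "u \<in> space M" for u
          using fb[OF that, of x] g_pos[of x u] by (auto simp: abs_mult intro!: mult_right_mono)
      qed (use fg_int g_int in auto)
      then show ?thesis by (simp add: g_one)
    qed
    show "\<bar>(LINT u|M. f x u * g x u) - (LINT u|M. f y u * g y u)\<bar> \<le> F * (1 + c * exp c) * dist x y powr \<alpha>"
      if xy: "dist x y \<le> 1" for x y
    proof -
      let ?d = "dist x y powr \<alpha>"
      \<comment> \<open>The density is the exponential of a logarithm that stays below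
        \<open>c\<close> and has Hoelder constant \<open>2 * B = c\<close>.\<close>
      have gd: "\<bar>g x u - g y u\<bar> \<le> c * exp c * ?d" if u: "u \<in> space M" for u
      proof -
        have "\<bar>g x u - g y u\<bar> \<le> exp c * \<bar>ln (g x u) - ln (g y u)\<bar>"
          using abs_diff_exp_le[OF ln_g[OF u, of x] ln_g[OF u, of y]] g_exp by metis
        also have "\<dots> \<le> exp c * (2 * (B * ?d))"
          unfolding g_def
          by (intro mult_left_mono ln_gibbs_diff_le[OF k kb k kb _ u])
             (auto intro: holder_boundedD(4)[OF kB xy])
        finally show ?thesis by (simp add: c algebra_simps)
      qed
      have "\<bar>(LINT u|M. f x u * g x u) - (LINT u|M. f y u * g y u)\<bar>
          = \<bar>LINT u|M. f x u * g x u - f y u * g y u\<bar>"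
        by (simp add: fg_int)
      also have "\<dots> \<le> (LINT u|M. (F * ?d) * g x u + F * (c * exp c * ?d))"
      proof (rule abs_integral_le)
        fix u assume u: "u \<in> space M"
        \<comment> \<open>The difference of \<open>f\<close> stays multiplied by the density and
          integrates to the summand 1 in \<open>1 + c * exp c\<close>; the difference of the
          densities is bounded pointwise and gives the rest.\<close>
        have "\<bar>f x u * g x u - f y u * g y u\<bar> = \<bar>(f x u - f y u) * g x u + f y u * (g x u - g y u)\<bar>"
          by (simp add: algebra_simps)
        also have "\<dots> \<le> \<bar>f x u - f y u\<bar> * g x u + \<bar>f y u\<bar> * \<bar>g x u - g y u\<bar>"
          using abs_triangle_ineq[of "(f x u - f y u) * g x u" "f y u * (g x u - g y u)"] g_pos[of x u]
          by (simp add: abs_mult)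
        also have "\<dots> \<le> (F * ?d) * g x u + F * (c * exp c * ?d)"
          using holder_boundedD(4)[OF fF[OF u] xy] fb[OF u, of y] gd[OF u] g_pos[of x u] F0
          by (intro add_mono mult_mono) auto
        finally show "\<bar>f x u * g x u - f y u * g y u\<bar> \<le> (F * ?d) * g x u + F * (c * exp c * ?d)" .
      qed (use fg_int g_int in auto)
      also have "\<dots> = F * (1 + c * exp c) * ?d"
        using g_int by (simp add: g_one prob_space algebra_simps)
      finally show ?thesis .
    qed
  qed
qed

end

section \<open>Matrix expressions in coordinates and the bound for the averaged coefficients\<close>

lemma trace_mult_eq_sum:
  "trace (A ** B :: real^'n^'n) = (\<Sum>i\<in>UNIV. \<Sum>j\<in>UNIV. A $ i $ j * B $ j $ i)"
  by (simp add: trace_def matrix_matrix_mult_def)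

lemma inner_matrix_vector_eq_sum:
  "\<xi> \<bullet> (A *v \<xi> :: real^'n) = (\<Sum>i\<in>UNIV. \<Sum>j\<in>UNIV. \<xi> $ i * \<xi> $ j * A $ i $ j)"
  by (simp add: inner_vec_def matrix_vector_mult_def sum_distrib_left mult_ac)

lemma inner_eq_sum: "x \<bullet> y = (\<Sum>i\<in>UNIV. x $ i * y $ i)" for x y :: "real^'n"
  by (simp add: inner_vec_def)

lemma diffusion_nth:
  "diffusion \<sigma> x u $ i $ j = (\<Sum>k\<in>UNIV. \<sigma> x u $ i $ k * \<sigma> x u $ j $ k)"
  by (simp add: diffusion_def matrix_matrix_mult_def transpose_def)

lemma borel_measurable_vec_nth [measurable (raw)]:
  assumes "f \<in> borel_measurable M"
  shows "(\<lambda>u. f u $ i :: 'a::topological_space) \<in> borel_measurable M"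
  using assms by (rule borel_measurable_continuous_on[rotated]) (intro continuous_intros)

text \<open>Here \<open>(C\<^sub>0 + B) / lam\<close> bounds the exponent of the policy,
  \<open>c\<close> the logarithm of the policy, and \<open>C\<^sub>0 + lam * c\<close> the reward
  together with the entropy term. The last factor adds the sup bound \<open>F\<close> of an average
  to its Hoelder constant \<open>F * (1 + c * exp c)\<close>.\<close>

definition coeff_bound :: "real \<Rightarrow> real \<Rightarrow> real \<Rightarrow> real"
  where "coeff_bound C\<^sub>0 lam B =
    (let c = 2 * ((C\<^sub>0 + B) / lam) in (C\<^sub>0 + lam * c) * (2 + c * exp c))"

lemma coeff_bound_ge_1:
  assumes "1 \<le> C\<^sub>0" "0 < lam" "0 \<le> B"
  shows "1 \<le> coeff_bound C\<^sub>0 lam B"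
proof -
  define c where "c = 2 * ((C\<^sub>0 + B) / lam)"
  have "0 \<le> c" using assms by (simp add: c_def)
  moreover have "0 \<le> lam * c" using \<open>0 \<le> c\<close> assms(2) by simp
  ultimately have "1 * 1 \<le> (C\<^sub>0 + lam * c) * (2 + c * exp c)"
    using assms(1) by (intro mult_mono add_increasing2) auto
  then show ?thesis by (simp add: coeff_bound_def Let_def c_def)
qed

section \<open>The policy and the averaged linear equation\<close>

text \<open>The control domain enters only as a probability space, so its dimension cannot influence
  any constant. All hypotheses are stated for scalar entries, ready for the calculus of
  \<open>holder_bounded\<close>.\<close>

locale relaxed_control = prob_space \<Omega> for \<Omega> :: "'u measure" +
  fixes \<alpha> C\<^sub>0 lam :: real
    and r :: "real^'d \<Rightarrow> 'u \<Rightarrow> real"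
    and b :: "real^'d \<Rightarrow> 'u \<Rightarrow> real^'d"
    and \<sigma> :: "real^'d \<Rightarrow> 'u \<Rightarrow> real^'m^'d"
    and \<Sigma>\<^sub>0 :: "real^'d \<Rightarrow> real^'d^'d"
    and \<epsilon>\<^sub>0 \<epsilon>\<^sub>1 :: real
  assumes C\<^sub>0: "1 \<le> C\<^sub>0" and lam: "0 < lam"
    and r_meas [measurable]: "\<And>x. r x \<in> borel_measurable \<Omega>"
    and b_meas [measurable]: "\<And>x. b x \<in> borel_measurable \<Omega>"
    and \<sigma>_meas [measurable]: "\<And>x. \<sigma> x \<in> borel_measurable \<Omega>"
    and elliptic: "\<And>x u. u \<in> space \<Omega> \<Longrightarrow> quadform_le ((1 / C\<^sub>0) *\<^sub>R mat 1) (diffusion \<sigma> x u)"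
    and r_holder: "\<And>u. u \<in> space \<Omega> \<Longrightarrow> holder_bounded \<alpha> C\<^sub>0 C\<^sub>0 (\<lambda>x. r x u)"
    and b_holder: "\<And>u i. u \<in> space \<Omega> \<Longrightarrow> holder_bounded \<alpha> C\<^sub>0 C\<^sub>0 (\<lambda>x. b x u $ i)"
    and \<Sigma>_holder: "\<And>u i j. u \<in> space \<Omega> \<Longrightarrow> holder_bounded \<alpha> C\<^sub>0 C\<^sub>0 (\<lambda>x. diffusion \<sigma> x u $ i $ j)"
    and M_holder: "\<And>u i j. u \<in> space \<Omega> \<Longrightarrow>
      holder_bounded \<alpha> \<epsilon>\<^sub>0 \<epsilon>\<^sub>1 (\<lambda>x. (diffusion \<sigma> x u - \<Sigma>\<^sub>0 x) $ i $ j)"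
begin

lemma diffusion_meas [measurable]: "(\<lambda>u. diffusion \<sigma> x u $ i $ j) \<in> borel_measurable \<Omega>"
  unfolding diffusion_nth by measurable

text \<open>The reward is left out because its bound is fixed. Of the two terms kept, the first
  becomes small through the decay of the gradient in \<rho>, the second through
  \<open>\<epsilon>\<^sub>0\<close> and \<open>\<epsilon>\<^sub>1\<close>.\<close>

definition perturbation :: "(real^'d \<Rightarrow> real) \<Rightarrow> real^'d \<Rightarrow> 'u \<Rightarrow> real"
  where "perturbation w x u =
    b x u \<bullet> grad w x + 1/2 * trace ((diffusion \<sigma> x u - \<Sigma>\<^sub>0 x) ** hessian w x)"

lemma perturbation_meas [measurable]: "perturbation w x \<in> borel_measurable \<Omega>"
  unfolding perturbation_def trace_mult_eq_sum inner_eq_sum by simp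

text \<open>Each coordinate sum costs a factor \<open>D\<close>. The Hoelder constant
  \<open>Q'\<close> of the Hessian meets only \<open>\<epsilon>\<^sub>0\<close>, and
  \<open>\<epsilon>\<^sub>1\<close> meets only its sup bound \<open>Q\<close>; this is why the
  theorem has two separate smallness conditions.\<close>

lemma perturbation_holder:
  assumes u: "u \<in> space \<Omega>"
    and grad: "\<And>i. holder_bounded \<alpha> P P' (\<lambda>x. grad w x $ i)"
    and hess: "\<And>i j. holder_bounded \<alpha> Q Q' (\<lambda>x. hessian w x $ i $ j)"
    and D: "D = real CARD('d)"
  shows "holder_bounded \<alpha> (D * (C\<^sub>0 * P) + 1/2 * (D * (D * (\<epsilon>\<^sub>0 * Q))))
    (D * (C\<^sub>0 * P' + C\<^sub>0 * P) + 1/2 * (D * (D * (\<epsilon>\<^sub>0 * Q' + \<epsilon>\<^sub>1 * Q)))) (\<lambda>x. perturbation w x u)"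
proof -
  have "holder_bounded \<alpha> (D * (C\<^sub>0 * P)) (D * (C\<^sub>0 * P' + C\<^sub>0 * P)) (\<lambda>x. b x u \<bullet> grad w x)"
    unfolding inner_eq_sum D
    by (intro holder_bounded_sum holder_bounded_mult b_holder u grad)
  moreover have "holder_bounded \<alpha> (D * (D * (\<epsilon>\<^sub>0 * Q))) (D * (D * (\<epsilon>\<^sub>0 * Q' + \<epsilon>\<^sub>1 * Q)))
      (\<lambda>x. trace ((diffusion \<sigma> x u - \<Sigma>\<^sub>0 x) ** hessian w x))"
    unfolding trace_mult_eq_sum D
    by (intro holder_bounded_sum holder_bounded_mult M_holder u hess)
  then have "holder_bounded \<alpha> (1/2 * (D * (D * (\<epsilon>\<^sub>0 * Q)))) (1/2 * (D * (D * (\<epsilon>\<^sub>0 * Q' + \<epsilon>\<^sub>1 * Q))))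
      (\<lambda>x. 1/2 * trace ((diffusion \<sigma> x u - \<Sigma>\<^sub>0 x) ** hessian w x))"
    using holder_bounded_cmult[of _ _ _ _ "1/2"] by simp
  ultimately show ?thesis
    unfolding perturbation_def by (rule holder_bounded_add)
qed

lemma policy_eq_gibbs:
  "policy \<Omega> lam r b \<sigma> w x = gibbs \<Omega> (\<lambda>u. 1 / lam * (r x u + perturbation w x u))"
proof -
  have "hamiltonian r b \<sigma> w x u =
      r x u + perturbation w x u + 1/2 * trace (\<Sigma>\<^sub>0 x ** hessian w x)" for u
    unfolding hamiltonian_def perturbation_def trace_mult_eq_sum
    by (simp add: left_diff_distrib sum_subtractf algebra_simps)
  \<comment> \<open>The second line of the exponent is constant in \<open>u\<close>.\<close>
  then have "policy \<Omega> lam r b \<sigma> w x = gibbs \<Omega> (\<lambda>u. 1 / lam * (r x u + perturbation w x u)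
      + 1 / lam * (1/2 * trace (\<Sigma>\<^sub>0 x ** hessian w x)))"
    by (simp add: policy_def gibbs_def distrib_left fun_eq_iff)
  then show ?thesis by (simp only: gibbs_add_const)
qed

text \<open>For a frozen policy the equation is linear in the unknown. Its coefficients are the
  averages of \<open>r - lam * ln p\<close>, \<open>b\<close> and \<open>diffusion\<close> against
  the policy \<open>p\<close> of \<open>w\<close>; they do not depend on \<open>v\<close>. Averaging
  against a probability density preserves symmetry and ellipticity.\<close>

lemma averaged_equation:
  assumes pert: "\<forall>u\<in>space \<Omega>. holder_bounded \<alpha> B B (\<lambda>x. perturbation w x u)"
  obtains R :: "real^'d \<Rightarrow> real" and \<beta> :: "real^'d \<Rightarrow> real^'d" and S :: "real^'d \<Rightarrow> real^'d^'d"
  where "\<And>x. transpose (S x) = S x"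
    and "\<And>x. quadform_le ((1 / C\<^sub>0) *\<^sub>R mat 1) (S x)"
    and "holder_norm 0 \<alpha> R \<le> ennreal (coeff_bound C\<^sub>0 lam B)"
    and "holder_norm 0 \<alpha> \<beta> \<le> ennreal (coeff_bound C\<^sub>0 lam B)"
    and "holder_norm 0 \<alpha> S \<le> ennreal (coeff_bound C\<^sub>0 lam B)"
    and "\<And>v x. (LINT u|\<Omega>. (hamiltonian r b \<sigma> v x u - lam * ln (policy \<Omega> lam r b \<sigma> w x u))
        * policy \<Omega> lam r b \<sigma> w x u)
      = R x + \<beta> x \<bullet> grad v x + 1/2 * trace (S x ** hessian v x)"
proof -
  define k where "k x u = 1 / lam * (r x u + perturbation w x u)" for x u
  define p where "p x u = gibbs \<Omega> (k x) u" for x u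
  define H where "H = (C\<^sub>0 + B) / lam"
  define c where "c = 2 * H"
  define \<phi> where "\<phi> x u = r x u - lam * ln (p x u)" for x u
  define R where "R x = (LINT u|\<Omega>. \<phi> x u * p x u)" for x
  define \<beta> where "\<beta> x = (\<chi> i. LINT u|\<Omega>. b x u $ i * p x u)" for x
  define S where "S x = (\<chi> i j. LINT u|\<Omega>. diffusion \<sigma> x u $ i $ j * p x u)" for x
  obtain u0 where "u0 \<in> space \<Omega>" using not_empty by blast
  with pert have B0: "0 \<le> B" using holder_boundedD(1) by blast
  have H0: "0 \<le> H" using B0 C\<^sub>0 lam by (simp add: H_def)
  have c0: "0 \<le> c" using H0 by (simp add: c_def)
  have lc0: "0 \<le> lam * c" using c0 lam by simp
  have k_meas [measurable]: "k x \<in> borel_measurable \<Omega>" for x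
    unfolding k_def by measurable
  have p_meas [measurable]: "p x \<in> borel_measurable \<Omega>" for x
    unfolding p_def by measurable
  have \<phi>_meas [measurable]: "\<phi> x \<in> borel_measurable \<Omega>" for x
    unfolding \<phi>_def by measurable
  have k_holder: "holder_bounded \<alpha> H H (\<lambda>x. k x u)" if "u \<in> space \<Omega>" for u
    using holder_bounded_cmult[OF holder_bounded_add[OF r_holder[OF that] bspec[OF pert that]], of "1 / lam"] lam
    by (simp add: k_def H_def)
  have k_bound: "\<bar>k x u\<bar> \<le> H" if "u \<in> space \<Omega>" for x u
    using holder_boundedD(3)[OF k_holder[OF that]] .
  have ln_p_holder: "holder_bounded \<alpha> c c (\<lambda>x. ln (p x u))" if u: "u \<in> space \<Omega>" for u
  proof (rule holder_boundedI)
    show "\<bar>ln (p x u)\<bar> \<le> c" for x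
      unfolding p_def c_def using ln_gibbs_le[OF k_meas k_bound u] .
    show "\<bar>ln (p x u) - ln (p y u)\<bar> \<le> c * dist x y powr \<alpha>" if "dist x y \<le> 1" for x y
      using ln_gibbs_diff_le[OF k_meas k_bound k_meas k_bound holder_boundedD(4)[OF k_holder that] u]
      unfolding p_def c_def by simp
  qed (use c0 in auto)
  have \<phi>_holder: "holder_bounded \<alpha> (C\<^sub>0 + lam * c) (C\<^sub>0 + lam * c) (\<lambda>x. \<phi> x u)" if "u \<in> space \<Omega>" for u
    using holder_bounded_add[OF r_holder[OF that] holder_bounded_cmult[OF ln_p_holder[OF that], of "- lam"]] lam
    by (simp add: \<phi>_def)
  have p_pos: "0 < p x u" for x u
    unfolding p_def using gibbs_pos[OF k_meas k_bound] .
  have p_one: "(LINT u|\<Omega>. p x u) = 1" for x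
    unfolding p_def using integral_gibbs[OF k_meas k_bound] .
  have p_le: "p x u \<le> exp c" if "u \<in> space \<Omega>" for x u
    using holder_boundedD(3)[OF ln_p_holder[OF that], of x] p_pos[of x u]
    by (metis abs_le_D1 exp_le_cancel_iff exp_ln)
  have p_int: "integrable \<Omega> (p x)" for x
    by (rule integrable_bounded[where B = "exp c"])
       (use p_le p_pos in \<open>auto simp: abs_of_pos\<close>)
  have int: "integrable \<Omega> (\<lambda>u. f u * p x u)"
    if "f \<in> borel_measurable \<Omega>" "\<And>u. u \<in> space \<Omega> \<Longrightarrow> \<bar>f u\<bar> \<le> F" for f F x
  proof (rule integrable_bounded[where B = "F * exp c"])
    show "(\<lambda>u. f u * p x u) \<in> borel_measurable \<Omega>"
      using that(1) by measurable
    show "\<bar>f u * p x u\<bar> \<le> F * exp c" if "u \<in> space \<Omega>" for u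
      using p_pos[of x u] p_le[OF that, of x] \<open>\<And>u. u \<in> space \<Omega> \<Longrightarrow> \<bar>f u\<bar> \<le> F\<close>[OF that]
      by (auto simp: abs_mult intro!: mult_mono)
  qed
  have \<phi>_int: "integrable \<Omega> (\<lambda>u. \<phi> x u * p x u)" for x
    using int[OF \<phi>_meas holder_boundedD(3)[OF \<phi>_holder]] .
  have b_int: "integrable \<Omega> (\<lambda>u. b x u $ i * p x u)" for x i
    by (rule int[OF _ holder_boundedD(3)[OF b_holder]]) auto
  have \<Sigma>_int: "integrable \<Omega> (\<lambda>u. diffusion \<sigma> x u $ i $ j * p x u)" for x i j
    by (rule int[OF _ holder_boundedD(3)[OF \<Sigma>_holder]]) auto
  \<comment> \<open>Used with \<open>F = C\<^sub>0\<close> for the drift and the diffusion, and with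
    \<open>F = C\<^sub>0 + lam * c\<close> for the reward with entropy.\<close>
  have bound_mono: "F + F * (1 + c * exp c) \<le> coeff_bound C\<^sub>0 lam B" if "0 \<le> F" "F \<le> C\<^sub>0 + lam * c" for F
  proof -
    have "F + F * (1 + c * exp c) = F * (2 + c * exp c)" by (simp add: algebra_simps)
    also have "\<dots> \<le> (C\<^sub>0 + lam * c) * (2 + c * exp c)"
      using that c0 by (intro mult_right_mono) auto
    finally show ?thesis by (simp add: coeff_bound_def Let_def c_def H_def)
  qed
  show thesis
  proof
    show "transpose (S x) = S x" for x
      by (simp add: S_def transpose_def vec_eq_iff diffusion_nth mult.commute)
    show "quadform_le ((1 / C\<^sub>0) *\<^sub>R mat 1) (S x)" for x
      unfolding quadform_le_def
    proof
      fix \<xi> :: "real^'d"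
      \<comment> \<open>The constant is written as its own average, so that pointwise ellipticity
        can be integrated.\<close>
      have "\<xi> \<bullet> (((1 / C\<^sub>0) *\<^sub>R mat 1) *v \<xi>)
          = (LINT u|\<Omega>. (\<xi> \<bullet> (((1 / C\<^sub>0) *\<^sub>R mat 1) *v \<xi>)) * p x u)"
        by (simp add: p_one)
      also have "\<dots> \<le> (LINT u|\<Omega>. (\<Sum>i\<in>UNIV. \<Sum>j\<in>UNIV. \<xi> $ i * \<xi> $ j * (diffusion \<sigma> x u $ i $ j * p x u)))"
      proof (rule integral_mono)
        fix u assume "u \<in> space \<Omega>"
        then have "\<xi> \<bullet> (((1 / C\<^sub>0) *\<^sub>R mat 1) *v \<xi>) * p x u \<le> \<xi> \<bullet> (diffusion \<sigma> x u *v \<xi>) * p x u"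
          using elliptic[of u x] p_pos[of x u] unfolding quadform_le_def
          by (intro mult_right_mono) auto
        then show "\<xi> \<bullet> (((1 / C\<^sub>0) *\<^sub>R mat 1) *v \<xi>) * p x u
            \<le> (\<Sum>i\<in>UNIV. \<Sum>j\<in>UNIV. \<xi> $ i * \<xi> $ j * (diffusion \<sigma> x u $ i $ j * p x u))"
          by (simp add: inner_matrix_vector_eq_sum[of _ "diffusion \<sigma> x u"] sum_distrib_left sum_distrib_right mult_ac)
      qed (use p_int \<Sigma>_int in auto)
      also have "\<dots> = \<xi> \<bullet> (S x *v \<xi>)"
        by (simp add: inner_matrix_vector_eq_sum S_def \<Sigma>_int)
      finally show "\<xi> \<bullet> (((1 / C\<^sub>0) *\<^sub>R mat 1) *v \<xi>) \<le> \<xi> \<bullet> (S x *v \<xi>)" .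
    qed
    have F: "0 \<le> C\<^sub>0 + lam * c" "0 \<le> (C\<^sub>0 + lam * c) * (1 + c * exp c)"
      and G: "0 \<le> C\<^sub>0" "0 \<le> C\<^sub>0 * (1 + c * exp c)" "C\<^sub>0 \<le> C\<^sub>0 + lam * c"
      using C\<^sub>0 lc0 c0 by auto
    have "holder_bounded \<alpha> (C\<^sub>0 + lam * c) ((C\<^sub>0 + lam * c) * (1 + c * exp c)) R"
      unfolding R_def p_def
      by (intro holder_bounded_gibbs_average[OF k_meas k_holder \<phi>_meas \<phi>_holder c_def])
    then show "holder_norm 0 \<alpha> R \<le> ennreal (coeff_bound C\<^sub>0 lam B)"
      by (rule holder_norm_0_le[OF holder_bounded_real_iff[OF F, THEN iffD2] F bound_mono[OF F(1) order_refl]])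
    have "holder_bounded \<alpha> C\<^sub>0 (C\<^sub>0 * (1 + c * exp c)) (\<lambda>x. \<beta> x $ i)" for i
      unfolding \<beta>_def p_def vec_lambda_beta
      by (intro holder_bounded_gibbs_average[OF k_meas k_holder _ b_holder c_def]) auto
    then show "holder_norm 0 \<alpha> \<beta> \<le> ennreal (coeff_bound C\<^sub>0 lam B)"
      by (intro holder_norm_0_le[OF holder_bounded_vec_iff[OF G(1,2), THEN iffD2] G(1,2) bound_mono[OF G(1,3)]] allI)
    have "holder_bounded \<alpha> C\<^sub>0 (C\<^sub>0 * (1 + c * exp c)) (\<lambda>x. S x $ i $ j)" for i j
      unfolding S_def p_def vec_lambda_beta
      by (intro holder_bounded_gibbs_average[OF k_meas k_holder _ \<Sigma>_holder c_def]) auto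
    then show "holder_norm 0 \<alpha> S \<le> ennreal (coeff_bound C\<^sub>0 lam B)"
      by (intro holder_norm_0_le[OF holder_bounded_mat_iff[OF G(1,2), THEN iffD2] G(1,2) bound_mono[OF G(1,3)]] allI)
    show "(LINT u|\<Omega>. (hamiltonian r b \<sigma> v x u - lam * ln (policy \<Omega> lam r b \<sigma> w x u))
        * policy \<Omega> lam r b \<sigma> w x u)
      = R x + \<beta> x \<bullet> grad v x + 1/2 * trace (S x ** hessian v x)" for v x
    proof -
      have pol: "policy \<Omega> lam r b \<sigma> w x u = p x u" for u
        unfolding policy_eq_gibbs p_def k_def ..
      have "(LINT u|\<Omega>. (hamiltonian r b \<sigma> v x u - lam * ln (p x u)) * p x u)
        = (LINT u|\<Omega>. \<phi> x u * p x u + (\<Sum>i\<in>UNIV. grad v x $ i * (b x u $ i * p x u))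
          + 1/2 * (\<Sum>i\<in>UNIV. \<Sum>j\<in>UNIV. hessian v x $ j $ i * (diffusion \<sigma> x u $ i $ j * p x u)))"
        unfolding hamiltonian_def trace_mult_eq_sum inner_eq_sum \<phi>_def
        by (intro Bochner_Integration.integral_cong refl)
           (simp add: algebra_simps sum_distrib_left)
      also have "\<dots> = (LINT u|\<Omega>. \<phi> x u * p x u)
          + (\<Sum>i\<in>UNIV. grad v x $ i * (LINT u|\<Omega>. b x u $ i * p x u))
          + 1/2 * (\<Sum>i\<in>UNIV. \<Sum>j\<in>UNIV. hessian v x $ j $ i * (LINT u|\<Omega>. diffusion \<sigma> x u $ i $ j * p x u))"
        by (simp add: \<phi>_int b_int \<Sigma>_int)
      also have "\<dots> = R x + \<beta> x \<bullet> grad v x + 1/2 * trace (S x ** hessian v x)"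
        unfolding trace_mult_eq_sum inner_eq_sum R_def \<beta>_def S_def
        by (simp add: mult.commute)
      finally show ?thesis by (simp add: pol)
    qed
  qed
qed

text \<open>The a priori estimates for the averaged equation. \<open>L\<close> sees the previous
  iterate only through \<open>B\<close> and does not involve \<rho>, so the final constant can be
  chosen before \<rho>. The quotients feed the next perturbation; the last bound has the form of the
  final claim.\<close>

lemma next_iterate_bounds:
  fixes v w :: "real^'d \<Rightarrow> real"
  assumes apriori: "apriori_bound TYPE('d) \<alpha> C\<^sub>0 \<eta>" and \<rho>: "1 \<le> \<rho>"
    and pert: "\<forall>u\<in>space \<Omega>. holder_bounded \<alpha> B B (\<lambda>x. perturbation w x u)"
    and v: "bounded_classical v"
    and eq: "\<And>x. \<rho> * v x -
      (LINT u|\<Omega>. (hamiltonian r b \<sigma> v x u - lam * ln (policy \<Omega> lam r b \<sigma> w x u))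
        * policy \<Omega> lam r b \<sigma> w x u) = 0"
    and L: "L = \<eta> (coeff_bound C\<^sub>0 lam B)"
  shows "sup_norm v \<le> ennreal L"
    and "deriv_seminorm 1 v \<le> ennreal (L / \<rho> powr (1/2))"
    and "deriv_seminorm 2 v \<le> ennreal L"
    and "holder_seminorm 1 \<alpha> v \<le> ennreal (L / \<rho> powr (1/2 - \<alpha>/2))"
    and "holder_seminorm 2 \<alpha> v \<le> ennreal (L / \<rho> powr (- \<alpha>/2))"
    and "ennreal (\<rho> powr (- \<alpha>/2)) * holder_seminorm 2 \<alpha> v \<le> ennreal L"
proof -
  obtain u0 where "u0 \<in> space \<Omega>" using not_empty by blast
  with pert have B0: "0 \<le> B" using holder_boundedD(1) by blast
  note A = coeff_bound_ge_1[OF C\<^sub>0 lam B0]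
  have L1: "1 \<le> L"
    using apriori A unfolding apriori_bound_def L by simp
  obtain R \<beta> S where coeffs: "\<And>x. transpose (S x) = S x"
      "\<And>x. quadform_le ((1 / C\<^sub>0) *\<^sub>R mat 1) (S x)"
      "holder_norm 0 \<alpha> R \<le> ennreal (coeff_bound C\<^sub>0 lam B)"
      "holder_norm 0 \<alpha> \<beta> \<le> ennreal (coeff_bound C\<^sub>0 lam B)"
      "holder_norm 0 \<alpha> S \<le> ennreal (coeff_bound C\<^sub>0 lam B)"
    and avg: "\<And>v x. (LINT u|\<Omega>. (hamiltonian r b \<sigma> v x u - lam * ln (policy \<Omega> lam r b \<sigma> w x u))
        * policy \<Omega> lam r b \<sigma> w x u)
      = R x + \<beta> x \<bullet> grad v x + 1/2 * trace (S x ** hessian v x)"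
    by (rule averaged_equation[OF pert]) (rule that)
  have "\<rho> * v x - R x - \<beta> x \<bullet> grad v x - 1/2 * trace (S x ** hessian v x) = 0" for x
    using eq[of x] unfolding avg by simp
  note bounds = apriori[unfolded apriori_bound_def, THEN conjunct2, THEN conjunct2, rule_format,
      OF \<rho> A coeffs v this, folded L]
  have "L / \<rho> \<le> L" using \<rho> L1 by (simp add: divide_le_eq)
  then show "sup_norm v \<le> ennreal L"
    using ennreal_mult_leD[OF bounds[THEN conjunct1]] \<rho> L1 by (auto intro: order_trans ennreal_leI)
  show "deriv_seminorm 2 v \<le> ennreal L"
    "ennreal (\<rho> powr (- \<alpha>/2)) * holder_seminorm 2 \<alpha> v \<le> ennreal L"
    using bounds by blast+
  show "deriv_seminorm 1 v \<le> ennreal (L / \<rho> powr (1/2))"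
    "holder_seminorm 1 \<alpha> v \<le> ennreal (L / \<rho> powr (1/2 - \<alpha>/2))"
    "holder_seminorm 2 \<alpha> v \<le> ennreal (L / \<rho> powr (- \<alpha>/2))"
    using bounds \<rho> L1 by (auto intro!: ennreal_mult_leD)
qed

end

section \<open>Induction over the iterates\<close>

text \<open>\<open>N\<close> collects the dimensional factors of \<open>perturbation_holder\<close>:
  gradient bounds \<open>1 / N\<close> together with products of \<open>\<epsilon>\<^sub>0\<close>,
  \<open>\<epsilon>\<^sub>1\<close> and Hessian bounds of size \<open>1 / N\<close> give a
  perturbation of size at most 1. In \<open>1 + N * K\<close> the summand \<open>N * K\<close>
  covers the initial function and 1 covers every later iterate.\<close>

lemma (in relaxed_control) iterate_bounds:
  fixes v :: "nat \<Rightarrow> real^'d \<Rightarrow> real"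
  assumes apriori: "apriori_bound TYPE('d) \<alpha> C\<^sub>0 \<eta>"
    and \<alpha>: "0 < \<alpha>" "\<alpha> < 1"
    and K0: "0 \<le> K" and v0: "holder_norm 2 \<alpha> (v 0) \<le> ennreal K"
    and \<epsilon>: "\<epsilon>\<^sub>0 \<le> 1" "\<epsilon>\<^sub>1 \<le> 1"
    and N: "N = 2 * real CARD('d) * C\<^sub>0 + (real CARD('d))\<^sup>2"
    and L: "L = \<eta> (coeff_bound C\<^sub>0 lam (1 + N * K))"
    and \<rho>: "(N * L) powr (2 / (1 - \<alpha>)) \<le> \<rho>"
    and \<epsilon>\<^sub>0_small: "\<epsilon>\<^sub>0 * (N * L) * \<rho> powr (\<alpha>/2) \<le> 1"
    and \<epsilon>\<^sub>1_small: "\<epsilon>\<^sub>1 * (N * L) \<le> 1"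
    and pia: "policy_iteration \<Omega> lam \<rho> r b \<sigma> v"
    and n: "1 \<le> n"
  shows "C_norm 2 (v n) \<le> ennreal (N * L)"
    and "ennreal (\<rho> powr (- \<alpha>/2)) * holder_seminorm 2 \<alpha> (v n) \<le> ennreal (N * L)"
proof -
  define D where "D = real CARD('d)"
  have D1: "1 \<le> D" by (simp add: D_def Suc_le_eq)
  have N_D: "N = 2 * (D * C\<^sub>0) + D * D"
    by (simp add: N D_def power2_eq_square)
  have "1 * 1 \<le> D * C\<^sub>0" "1 * 1 \<le> D * D"
    using D1 C\<^sub>0 by (intro mult_mono; simp)+
  \<comment> \<open>The three terms of the \<open>C\<^sup>2\<close> norm are each at most
    \<open>L\<close>, and 3 is enough to absorb them into \<open>N * L\<close>.\<close>
  then have N3: "3 \<le> N" by (simp add: N_D)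
  have NK: "0 \<le> N * K" using N3 K0 by simp
  have L1: "1 \<le> L"
    using apriori coeff_bound_ge_1[OF C\<^sub>0 lam, of "1 + N * K"] NK
    unfolding apriori_bound_def L by simp
  have NL: "1 * 1 \<le> N * L" using N3 L1 by (intro mult_mono) auto
  then have "1 \<le> (N * L) powr (2 / (1 - \<alpha>))"
    using \<alpha> by (intro ge_one_powr_ge_zero) auto
  with \<rho> have \<rho>1: "1 \<le> \<rho>" by linarith
  \<comment> \<open>The exponent \<open>1/2 - \<alpha>/2\<close> is the reciprocal of
    \<open>2 / (1 - \<alpha>)\<close>. It is the decay rate of the Hoelder seminorm of the
    gradient.\<close>
  have \<rho>_large: "N * L \<le> \<rho> powr (1/2 - \<alpha>/2)"
  proof -
    have "N * L = ((N * L) powr (2 / (1 - \<alpha>))) powr (1/2 - \<alpha>/2)"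
    proof -
      have "2 / (1 - \<alpha>) * (1/2 - \<alpha>/2) = 1" using \<alpha> by (simp add: field_simps)
      then show ?thesis using NL unfolding powr_powr by simp
    qed
    also have "\<dots> \<le> \<rho> powr (1/2 - \<alpha>/2)"
      using \<rho> \<alpha> by (intro powr_mono2) auto
    finally show ?thesis .
  qed
  also have "\<rho> powr (1/2 - \<alpha>/2) \<le> \<rho> powr (1/2)"
    using \<rho>1 \<alpha> by (intro powr_mono) auto
  finally have \<rho>_half: "N * L \<le> \<rho> powr (1/2)" .
  have small: "L / t \<le> 1 / N" if "N * L \<le> t" for t
    using that N3 NL by (simp add: field_simps)
  obtain u0 where u0: "u0 \<in> space \<Omega>" using not_empty by blast
  have \<epsilon>_nonneg: "0 \<le> \<epsilon>\<^sub>0" "0 \<le> \<epsilon>\<^sub>1"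
    using holder_boundedD(1,2)[OF M_holder[OF u0]] by auto
  define B where "B = 1 + N * K"
  have classical: "bounded_classical (v (Suc n))" for n
    using pia unfolding policy_iteration_def by auto
  have equation: "\<rho> * v (Suc n) x -
    (LINT u|\<Omega>. (hamiltonian r b \<sigma> (v (Suc n)) x u - lam * ln (policy \<Omega> lam r b \<sigma> (v n) x u))
      * policy \<Omega> lam r b \<sigma> (v n) x u) = 0" for n x
    using pia[unfolded policy_iteration_def, rule_format, of "Suc n", THEN conjunct2, rule_format, of x]
    by simp
  have step: "sup_norm (v (Suc n)) \<le> ennreal L"
    "deriv_seminorm 1 (v (Suc n)) \<le> ennreal (L / \<rho> powr (1/2))"
    "deriv_seminorm 2 (v (Suc n)) \<le> ennreal L"
    "holder_seminorm 1 \<alpha> (v (Suc n)) \<le> ennreal (L / \<rho> powr (1/2 - \<alpha>/2))"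
    "holder_seminorm 2 \<alpha> (v (Suc n)) \<le> ennreal (L / \<rho> powr (- \<alpha>/2))"
    "ennreal (\<rho> powr (- \<alpha>/2)) * holder_seminorm 2 \<alpha> (v (Suc n)) \<le> ennreal L"
    if "\<forall>u\<in>space \<Omega>. holder_bounded \<alpha> B B (\<lambda>x. perturbation (v n) x u)" for n
    by (rule next_iterate_bounds[OF apriori \<rho>1 that classical equation L[folded B_def]])+
  \<comment> \<open>The induction carries the bound of the perturbation and not bounds of the
    iterate, because \<open>v 0\<close> solves no equation and need not satisfy the estimates in
    \<open>L\<close>.\<close>
  have pert: "\<forall>u\<in>space \<Omega>. holder_bounded \<alpha> B B (\<lambda>x. perturbation (v n) x u)" for n
  proof (induction n)
    case 0
    have v0_le: "deriv_seminorm j (v 0) \<le> ennreal K" "holder_seminorm j \<alpha> (v 0) \<le> ennreal K"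
      if "j \<le> 2" for j
    proof -
      have "deriv_seminorm j (v 0) + holder_seminorm j \<alpha> (v 0) \<le> holder_norm 2 \<alpha> (v 0)"
        unfolding holder_norm_def using that by (intro member_le_sum) auto
      with v0 show "deriv_seminorm j (v 0) \<le> ennreal K" "holder_seminorm j \<alpha> (v 0) \<le> ennreal K"
        by (auto intro: order_trans[rotated])
    qed
    \<comment> \<open>For the initial function only \<open>\<epsilon>\<^sub>0 \<le> 1\<close> and
      \<open>\<epsilon>\<^sub>1 \<le> 1\<close> are used; its perturbation is bounded but need not
      be small.\<close>
    have "\<epsilon>\<^sub>0 * K \<le> K" "\<epsilon>\<^sub>1 * K \<le> K"
      using \<epsilon> K0 by (auto intro: mult_left_le_one_le \<epsilon>_nonneg)
    then have "D * (D * (\<epsilon>\<^sub>0 * K)) \<le> D * (D * K)" "D * (D * (\<epsilon>\<^sub>1 * K)) \<le> D * (D * K)"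
      using D1 by (auto intro!: mult_left_mono)
    moreover have "0 \<le> D * (D * K)" "0 \<le> D * (C\<^sub>0 * K)" using D1 K0 C\<^sub>0 by auto
    moreover have "B = 1 + 2 * (D * (C\<^sub>0 * K)) + D * (D * K)"
      by (simp add: B_def N_D algebra_simps)
    ultimately have
      le_B: "D * (C\<^sub>0 * K) + 1/2 * (D * (D * (\<epsilon>\<^sub>0 * K))) \<le> B"
      "D * (C\<^sub>0 * K + C\<^sub>0 * K) + 1/2 * (D * (D * (\<epsilon>\<^sub>0 * K + \<epsilon>\<^sub>1 * K))) \<le> B"
      unfolding distrib_left by linarith+
    have grad: "holder_bounded \<alpha> K K (\<lambda>x. grad (v 0) x $ i)" for i
      by (intro holder_bounded_grad v0_le K0) auto
    have hess: "holder_bounded \<alpha> K K (\<lambda>x. hessian (v 0) x $ i $ j)" for i j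
      by (intro holder_bounded_hessian v0_le K0) auto
    show ?case
    proof
      fix u assume u: "u \<in> space \<Omega>"
      note * = perturbation_holder[OF u grad hess D_def]
      show "holder_bounded \<alpha> B B (\<lambda>x. perturbation (v 0) x u)"
        using * le_B by (rule holder_bounded_mono)
    qed
  next
    case (Suc n)
    note * = step[OF Suc.IH]
    let ?t = "\<rho> powr (\<alpha>/2)"
    have "L / \<rho> powr (- \<alpha>/2) = L * ?t" using powr_minus_divide[of \<rho> "\<alpha>/2"] by simp
    then have h2: "holder_seminorm 2 \<alpha> (v (Suc n)) \<le> ennreal (L * ?t)"
      using *(5) by simp
    have d1: "deriv_seminorm 1 (v (Suc n)) \<le> ennreal (1 / N)"
      using *(2) small[OF \<rho>_half] by (auto intro: order_trans ennreal_leI)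
    have h1: "holder_seminorm 1 \<alpha> (v (Suc n)) \<le> ennreal (1 / N)"
      using *(4) small[OF \<rho>_large] by (auto intro: order_trans ennreal_leI)
    have t1: "1 \<le> ?t" using \<rho>1 \<alpha> by (intro ge_one_powr_ge_zero) auto
    \<comment> \<open>These are the two smallness conditions divided by \<open>N\<close>. The first
      controls the Hoelder constant \<open>L * ?t\<close> of the Hessian and, since
      \<open>1 \<le> ?t\<close>, also its sup bound.\<close>
    have e0: "\<epsilon>\<^sub>0 * (L * ?t) \<le> 1 / N" and e1: "\<epsilon>\<^sub>1 * L \<le> 1 / N"
      using \<epsilon>\<^sub>0_small \<epsilon>\<^sub>1_small N3 by (simp_all add: field_simps)
    have "\<epsilon>\<^sub>0 * (L * 1) \<le> \<epsilon>\<^sub>0 * (L * ?t)"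
      using t1 L1 \<epsilon>_nonneg by (intro mult_left_mono) auto
    with e0 have e0': "\<epsilon>\<^sub>0 * L \<le> 1 / N" by simp
    have "D * (D * (\<epsilon>\<^sub>0 * L)) \<le> D * (D * (1 / N))"
      "D * (D * (\<epsilon>\<^sub>0 * (L * ?t))) \<le> D * (D * (1 / N))"
      "D * (D * (\<epsilon>\<^sub>1 * L)) \<le> D * (D * (1 / N))"
      using D1 by (intro mult_left_mono e0 e0' e1; simp)+
    moreover have "0 \<le> D * (C\<^sub>0 * (1 / N))" "0 \<le> D * (D * (1 / N))" using D1 C\<^sub>0 N3 by auto
    \<comment> \<open>This identity dictates the value of \<open>N\<close>.\<close>
    moreover have "2 * (D * (C\<^sub>0 * (1 / N))) + D * (D * (1 / N)) = 1"
    proof -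
      have "2 * (D * (C\<^sub>0 * (1 / N))) + D * (D * (1 / N)) = N * (1 / N)"
        unfolding N_D distrib_right by (simp only: mult.assoc)
      then show ?thesis using N3 by simp
    qed
    moreover have "1 \<le> B" using NK by (simp add: B_def)
    ultimately have
      le_B: "D * (C\<^sub>0 * (1 / N)) + 1/2 * (D * (D * (\<epsilon>\<^sub>0 * L))) \<le> B"
      "D * (C\<^sub>0 * (1 / N) + C\<^sub>0 * (1 / N)) + 1/2 * (D * (D * (\<epsilon>\<^sub>0 * (L * ?t) + \<epsilon>\<^sub>1 * L))) \<le> B"
      unfolding distrib_left by linarith+
    have nonneg: "0 \<le> 1 / N" "0 \<le> L" "0 \<le> L * ?t" using N3 L1 by auto
    have grad: "holder_bounded \<alpha> (1 / N) (1 / N) (\<lambda>x. grad (v (Suc n)) x $ i)" for i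
      by (rule holder_bounded_grad[OF d1 h1 nonneg(1,1)])
    have hess: "holder_bounded \<alpha> L (L * ?t) (\<lambda>x. hessian (v (Suc n)) x $ i $ j)" for i j
      by (rule holder_bounded_hessian[OF *(3) h2 nonneg(2,3)])
    show ?case
    proof
      fix u assume u: "u \<in> space \<Omega>"
      note * = perturbation_holder[OF u grad hess D_def]
      show "holder_bounded \<alpha> B B (\<lambda>x. perturbation (v (Suc n)) x u)"
        using * le_B by (rule holder_bounded_mono)
    qed
  qed
  obtain m where m: "n = Suc m" using n by (cases n) auto
  note bounds = step[OF pert, of m, folded m]
  have le: "1 * L \<le> N * L" using N3 L1 by (intro mult_right_mono) auto
  have d1: "deriv_seminorm 1 (v n) \<le> ennreal L"
  proof -
    have "L / \<rho> powr (1/2) \<le> L" using \<rho>_half NL L1 by (simp add: divide_le_eq)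
    then show ?thesis using bounds(2) by (auto intro: order_trans ennreal_leI)
  qed
  have "C_norm 2 (v n) = sup_norm (v n) + deriv_seminorm 1 (v n) + deriv_seminorm 2 (v n)"
    by (simp add: C_norm_def numeral_2_eq_2 deriv_seminorm_def)
  also have "\<dots> \<le> ennreal L + ennreal L + ennreal L"
    by (intro add_mono bounds d1)
  also have "\<dots> = ennreal (3 * L)"
    using L1 by (simp flip: ennreal_plus)
  also have "\<dots> \<le> ennreal (N * L)"
    using N3 L1 by (intro ennreal_leI mult_right_mono) auto
  finally show "C_norm 2 (v n) \<le> ennreal (N * L)" .
  show "ennreal (\<rho> powr (- \<alpha>/2)) * holder_seminorm 2 \<alpha> (v n) \<le> ennreal (N * L)"
    using bounds(6) le by (auto intro: order_trans ennreal_leI)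
qed

section \<open>Choice of the constant and the concrete control domain\<close>

theorem theorem2p1:
  fixes \<alpha> C\<^sub>0 lam K :: real and \<eta> :: "real \<Rightarrow> real"
  assumes "0 < \<alpha>" "\<alpha> < 1" "1 \<le> C\<^sub>0" "0 < lam" "0 \<le> K"
    and "apriori_bound TYPE('d::finite) \<alpha> C\<^sub>0 \<eta>"
  shows "\<exists>A\<^sub>1\<ge>1. \<forall>(l::nat) (U :: (nat \<Rightarrow> real) set)
      (r :: real^'d \<Rightarrow> (nat \<Rightarrow> real) \<Rightarrow> real)
      (b :: real^'d \<Rightarrow> (nat \<Rightarrow> real) \<Rightarrow> real^'d)
      (\<sigma> :: real^'d \<Rightarrow> (nat \<Rightarrow> real) \<Rightarrow> real^'m::finite^'d)
      (\<Sigma>\<^sub>0 :: real^'d \<Rightarrow> real^'d^'d)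
      (\<epsilon>\<^sub>0::real) (\<epsilon>\<^sub>1::real) (\<rho>::real) (v :: nat \<Rightarrow> real^'d \<Rightarrow> real).
    0 < l \<longrightarrow> bounded_domain l U \<longrightarrow> emeasure (lebesgue_Rn l) U = 1 \<longrightarrow>
    (\<forall>x. r x \<in> borel_measurable (restrict_space (lebesgue_Rn l) U)) \<longrightarrow>
    (\<forall>x. b x \<in> borel_measurable (restrict_space (lebesgue_Rn l) U)) \<longrightarrow>
    (\<forall>x. \<sigma> x \<in> borel_measurable (restrict_space (lebesgue_Rn l) U)) \<longrightarrow>
    0 < \<epsilon>\<^sub>0 \<longrightarrow> \<epsilon>\<^sub>0 < 1 \<longrightarrow> 0 < \<epsilon>\<^sub>1 \<longrightarrow> \<epsilon>\<^sub>1 < 1 \<longrightarrow>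
    v 0 \<in> holder_space 2 \<alpha> \<longrightarrow> holder_norm 2 \<alpha> (v 0) = ennreal K \<longrightarrow>
    (\<forall>u\<in>U.
      (\<forall>x. quadform_le ((1 / C\<^sub>0) *\<^sub>R mat 1) (diffusion \<sigma> x u)) \<and>
      holder_norm 0 \<alpha> (\<lambda>x. r x u) \<le> ennreal C\<^sub>0 \<and>
      holder_norm 0 \<alpha> (\<lambda>x. b x u) \<le> ennreal C\<^sub>0 \<and>
      holder_norm 0 \<alpha> (\<lambda>x. diffusion \<sigma> x u) \<le> ennreal C\<^sub>0) \<longrightarrow>
    (\<forall>x. transpose (\<Sigma>\<^sub>0 x) = \<Sigma>\<^sub>0 x) \<longrightarrow>
    (SUP u\<in>U. sup_norm (\<lambda>x. diffusion \<sigma> x u - \<Sigma>\<^sub>0 x)) \<le> ennreal \<epsilon>\<^sub>0 \<longrightarrow>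
    (SUP u\<in>U. holder_seminorm 0 \<alpha> (\<lambda>x. diffusion \<sigma> x u - \<Sigma>\<^sub>0 x)) \<le> ennreal \<epsilon>\<^sub>1 \<longrightarrow>
    \<rho> \<ge> A\<^sub>1 powr (2 / (1 - \<alpha>)) \<longrightarrow>
    \<epsilon>\<^sub>0 * A\<^sub>1 * \<rho> powr (\<alpha>/2) \<le> 1 \<longrightarrow>
    \<epsilon>\<^sub>1 * A\<^sub>1 \<le> 1 \<longrightarrow>
    policy_iteration (restrict_space (lebesgue_Rn l) U) lam \<rho> r b \<sigma> v \<longrightarrow>
    (\<forall>n\<ge>1. C_norm 2 (v n) \<le> ennreal A\<^sub>1 \<and>
      ennreal (\<rho> powr (- \<alpha>/2)) * holder_seminorm 2 \<alpha> (v n) \<le> ennreal A\<^sub>1)"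
proof -
  \<comment> \<open>The witness will be \<open>N * L\<close>. It is built from the dimension,
    \<open>C\<^sub>0\<close>, \<open>lam\<close>, \<open>K\<close> and \<eta>, all fixed before the
    control domain, the coefficients and \<rho>.\<close>
  define N where "N = 2 * real CARD('d) * C\<^sub>0 + (real CARD('d))\<^sup>2"
  define L where "L = \<eta> (coeff_bound C\<^sub>0 lam (1 + N * K))"
  have D: "1 \<le> real CARD('d)" by (simp add: Suc_le_eq)
  have "1 * 1 \<le> real CARD('d) * C\<^sub>0"
    using D assms(3) by (intro mult_mono) auto
  then have N: "1 \<le> N"
    unfolding N_def mult.assoc using zero_le_power2[of "real CARD('d)"] by linarith
  then have "0 \<le> 1 + N * K" using assms(5) by simp
  then have "1 \<le> L"
    using assms(6) coeff_bound_ge_1[OF assms(3,4)] unfolding apriori_bound_def L_def by simp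
  with N have "1 * 1 \<le> N * L" by (intro mult_mono) auto
  show ?thesis
  proof (intro exI[of _ "N * L"] conjI[of "_ \<le> _" "\<forall>x. _ x"] allI impI, goal_cases)
    case 1
    show ?case using \<open>1 * 1 \<le> N * L\<close> by simp
  next
    case (2 l U r b \<sigma> \<Sigma>\<^sub>0 \<epsilon>\<^sub>0 \<epsilon>\<^sub>1 \<rho> v n)
    let ?\<Omega> = "restrict_space (lebesgue_Rn l) U"
    \<comment> \<open>A set outside the sigma-algebra has \<open>emeasure\<close> 0 by convention,
      so measure 1 forces measurability.\<close>
    have U: "U \<in> sets (lebesgue_Rn l)"
      using 2(3) emeasure_notin_sets by fastforce
    have space: "space ?\<Omega> = U"
      using sets.sets_into_space[OF U] by (auto simp: space_restrict_space)
    have prob: "prob_space ?\<Omega>"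
      using 2(3) U by (intro prob_spaceI) (simp add: space emeasure_restrict_space)
    have "relaxed_control ?\<Omega> \<alpha> C\<^sub>0 lam r b \<sigma> \<Sigma>\<^sub>0 \<epsilon>\<^sub>0 \<epsilon>\<^sub>1"
    proof (intro relaxed_control.intro prob relaxed_control_axioms.intro)
      fix u assume "u \<in> space ?\<Omega>"
      then have u: "u \<in> U" by (simp add: space)
      have C0: "0 \<le> C\<^sub>0" using assms(3) by simp
      note bd = 2(13)[rule_format, OF u]
      show "quadform_le ((1 / C\<^sub>0) *\<^sub>R mat 1) (diffusion \<sigma> x u)" for x
        using bd by blast
      show "holder_bounded \<alpha> C\<^sub>0 C\<^sub>0 (\<lambda>x. r x u)"
        using bd holder_norm_0_leD[of \<alpha> "\<lambda>x. r x u" C\<^sub>0]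
          holder_bounded_real_iff[OF C0 C0, of "\<lambda>x. r x u" \<alpha>] by blast
      show "holder_bounded \<alpha> C\<^sub>0 C\<^sub>0 (\<lambda>x. b x u $ i)" for i
        using bd holder_norm_0_leD[of \<alpha> "\<lambda>x. b x u" C\<^sub>0]
          holder_bounded_vec_iff[OF C0 C0, of "\<lambda>x. b x u" \<alpha>] by blast
      show "holder_bounded \<alpha> C\<^sub>0 C\<^sub>0 (\<lambda>x. diffusion \<sigma> x u $ i $ j)" for i j
        using bd holder_norm_0_leD[of \<alpha> "\<lambda>x. diffusion \<sigma> x u" C\<^sub>0]
          holder_bounded_mat_iff[OF C0 C0, of "\<lambda>x. diffusion \<sigma> x u" \<alpha>] by blast
      have "sup_norm (\<lambda>x. diffusion \<sigma> x u - \<Sigma>\<^sub>0 x) \<le> ennreal \<epsilon>\<^sub>0"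
        "holder_seminorm 0 \<alpha> (\<lambda>x. diffusion \<sigma> x u - \<Sigma>\<^sub>0 x) \<le> ennreal \<epsilon>\<^sub>1"
        using 2(15,16) u unfolding SUP_le_iff by blast+
      then show "holder_bounded \<alpha> \<epsilon>\<^sub>0 \<epsilon>\<^sub>1 (\<lambda>x. (diffusion \<sigma> x u - \<Sigma>\<^sub>0 x) $ i $ j)" for i j
        using holder_bounded_mat_iff[of \<epsilon>\<^sub>0 \<epsilon>\<^sub>1 "\<lambda>x. diffusion \<sigma> x u - \<Sigma>\<^sub>0 x" \<alpha>] 2(7,9) by simp
    qed (use assms 2(4-6) in auto)
    then interpret relaxed_control ?\<Omega> \<alpha> C\<^sub>0 lam r b \<sigma> \<Sigma>\<^sub>0 \<epsilon>\<^sub>0 \<epsilon>\<^sub>1 .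
    show ?case
      using iterate_bounds[OF assms(6,1,2,5) _ _ _ N_def L_def 2(17-20) 2(21)] 2(8,10,12)
      by simp
  qed
qed

end
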